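(* Let $\alpha(1),\dots,\alpha(d)\in\mathbb{N}_0^n$ be distinct vectors spanning $\mathbb{R}^n$, and let $f=\sum_{j=1}^d b_jZ^{\alpha(j)}\in\mathbb{C}[Z_1,\dots,Z_n]$ with $b_j\in\mathbb{C}^*$. Suppose that the point $\mathbf{1}=(1,\dots,1)$ is contained in the complement of $\mathcal{U}_f$ with $f\{0\}$ being lopsided with dominating element the one belonging to the monomial $Z^{\alpha(1)}$, i.e. $|b_1|>\sum_{i=2}^d|b_i|$. Let $$s_i=\left(\frac{(b_iZ^{\alpha(i)})^{\mathrm{re}}}{|b_i|}\right)^2+\left(\frac{(b_iZ^{\alpha(i)})^{\mathrm{im}}}{|b_i|}\right)^2-1\quad(1\le i\le d),\qquad s_{d+1}=f^{\mathrm{re}},\quad s_{d+2}=f^{\mathrm{im}}.$$ Then there exists a certificate of total degree $2\cdot\deg(f)$ (all summands $s_ig_i$ and $H$ have total degree at most $2\deg f$) $$\sum_{i=1}^{d+2}s_ig_i+H+1=0,$$ which is given, up to multiplying all of $g_1,\dots,g_{d+2},H$ by the common positive constant $\bigl(|b_1|^2-(\sum_{i=2}^d|b_i|)^2\bigr)^{-1}$, by $$g_1=|b_1|^2,\qquad g_i=-|b_i|\sum_{k=2}^d|b_k|\quad(2\le i\le d),$$ $$g_{d+1}=\Bigl(-b_1Z^{\alpha(1)}+\sum_{i=2}^d b_iZ^{\alpha(i)}\Bigr)^{\mathrm{re}},\qquad g_{d+2}=\Bigl(-b_1Z^{\alpha(1)}+\sum_{i=2}^d b_iZ^{\alpha(i)}\Bigr)^{\mathrm{im}},$$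 $$H=\sum_{2\le i<j\le d}|b_i||b_j|\left[\left(\frac{(b_iZ^{\alpha(i)})^{\mathrm{re}}}{|b_i|}-\frac{(b_jZ^{\alpha(j)})^{\mathrm{re}}}{|b_j|}\right)^2+\left(\frac{(b_iZ^{\alpha(i)})^{\mathrm{im}}}{|b_i|}-\frac{(b_jZ^{\alpha(j)})^{\mathrm{im}}}{|b_j|}\right)^2\right].$$
   Context: For $h\in\mathbb{C}[Z_1,\dots,Z_n]$, the real and imaginary parts $h^{\mathrm{re}},h^{\mathrm{im}}\in\mathbb{R}[X_1,\dots,X_n,Y_1,\dots,Y_n]$ are defined by $h(X+iY)=h^{\mathrm{re}}(X,Y)+i\,h^{\mathrm{im}}(X,Y)$, with $Z_k=X_k+iY_k$; the identities above are identities in $\mathbb{R}[X,Y]$. $\mathbb{C}^*=\mathbb{C}\setminus\{0\}$. The unlog amoeba of $f$ is $\mathcal{U}_f=\{(|z_1|,\dots,|z_n|) : z\in\mathbb{C}^n,\ f(z)=0\}$. For $v\in\mathbb{R}^n$, $f\{v\}$ is the list of positive reals $\bigl(|b_j|e^{\langle\alpha(j),v\rangle}\bigr)_{1\le j\le d}$ (the absolute values of the terms of $f$ at points $z$ with $(\log|z_1|,\dots,\log|z_n|)=v$); in particular $f\{0\}=(|b_1|,\dots,|b_d|)$. A list of positive reals is lopsided if one of its numbers (the dominating one) is greater than the sum of all the others. $\deg$ is the total degree. *)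

theory Defs
  imports "HOL-Analysis.Analysis" "HOL-Library.Poly_Mapping"
begin

text \<open>
  A polynomial is a finitely supported map from exponent vectors to coefficients, with the
  convolution product of \<^theory>\<open>HOL-Library.Poly_Mapping\<close>. The index type \<open>'n\<close> stands for
  \<open>{1..n}\<close>, so that \<open>('n, complex) mpoly\<close> is \<open>\<complex>[Z]\<close>; the polynomials in
  \<open>\<real>[X, Y]\<close> have type \<open>('n + 'n, real) mpoly\<close>.
\<close>

type_synonym ('v, 'a) mpoly = "('v \<Rightarrow>\<^sub>0 nat) \<Rightarrow>\<^sub>0 'a"

definition monomial :: "('v \<Rightarrow>\<^sub>0 nat) \<Rightarrow> 'a::zero \<Rightarrow> ('v, 'a) mpoly" where
  "monomial m c = Poly_Mapping.single m c"

definition Const :: "'a::zero \<Rightarrow> ('v, 'a) mpoly" where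
  "Const c = monomial 0 c"

definition Var :: "'v \<Rightarrow> ('v, 'a::zero_neq_one) mpoly" where
  "Var x = monomial (Poly_Mapping.single x 1) 1"

text \<open>The zero polynomial gets degree \<open>0\<close>.\<close>

definition total_degree :: "('v, 'a::zero) mpoly \<Rightarrow> nat" where
  "total_degree p =
     Max (insert 0 ((\<lambda>m. \<Sum>x\<in>Poly_Mapping.keys m. Poly_Mapping.lookup m x) ` Poly_Mapping.keys p))"

text \<open>Substitution of \<open>x k\<close> for the \<open>k\<close>-th variable, \<open>\<phi>\<close> being applied to the coefficients.\<close>

definition subst_mpoly :: "('a \<Rightarrow> 'r) \<Rightarrow> ('n::finite \<Rightarrow> 'r) \<Rightarrow> ('n, 'a::zero) mpoly \<Rightarrow> 'r::comm_ring_1" where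
  "subst_mpoly \<phi> x p =
     (\<Sum>m\<in>Poly_Mapping.keys p. \<phi> (Poly_Mapping.lookup p m) * (\<Prod>k\<in>UNIV. x k ^ Poly_Mapping.lookup m k))"

definition eval_mpoly :: "('n::finite, 'a::comm_ring_1) mpoly \<Rightarrow> 'a ^ 'n \<Rightarrow> 'a" where
  "eval_mpoly p z = subst_mpoly (\<lambda>c. c) (\<lambda>k. z $ k) p"

text \<open>The polynomial \<open>h(X + iY)\<close> in \<open>\<complex>[X, Y]\<close>; \<open>Inl k\<close> is the index of \<open>X\<^sub>k\<close>, \<open>Inr k\<close> that of \<open>Y\<^sub>k\<close>.\<close>

definition at_X_plus_iY :: "('n::finite, complex) mpoly \<Rightarrow> ('n + 'n, complex) mpoly" where
  "at_X_plus_iY h = subst_mpoly Const (\<lambda>k. Var (Inl k) + Const \<i> * Var (Inr k)) h"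

definition re_part :: "('n::finite, complex) mpoly \<Rightarrow> ('n + 'n, real) mpoly" where
  "re_part h = Poly_Mapping.map Re (at_X_plus_iY h)"

definition im_part :: "('n::finite, complex) mpoly \<Rightarrow> ('n + 'n, real) mpoly" where
  "im_part h = Poly_Mapping.map Im (at_X_plus_iY h)"

definition complexify :: "('v, real) mpoly \<Rightarrow> ('v, complex) mpoly" where
  "complexify p = Poly_Mapping.map complex_of_real p"

lemma lookup_Const_mult:
  "Poly_Mapping.lookup (Const c * p) m = c * Poly_Mapping.lookup p m"
  for p :: "('v, 'a::comm_ring_1) mpoly"
proof -
  have "Poly_Mapping.lookup (Const c * p) m =
      prod_fun (\<lambda>k. c when k = 0) (Poly_Mapping.lookup p) m"
    by (simp add: Const_def monomial_def times_poly_mapping.rep_eq single.rep_eq eq_commute)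
  also have "\<dots> = c * Poly_Mapping.lookup p m"
    by (simp add: prod_fun_def when_mult Sum_any_when_independent)
  finally show ?thesis .
qed

text \<open>
  The identity \<open>h(X + iY) = h\<^sup>r\<^sup>e + i h\<^sup>i\<^sup>m\<close> determines \<open>h\<^sup>r\<^sup>e\<close> and \<open>h\<^sup>i\<^sup>m\<close> among the real polynomials,
  and the definitions above satisfy it.
\<close>

lemma re_im_part_unique:
  "at_X_plus_iY h = complexify p + Const \<i> * complexify q \<longleftrightarrow> p = re_part h \<and> q = im_part h"
proof -
  have w: "(x when y \<noteq> 0) = x" if "y = 0 \<Longrightarrow> x = 0" for x :: "'z::zero" and y :: "'y::zero"
    using that by (simp add: when_def)
  have P: "p = re_part h \<longleftrightarrow>
      (\<forall>m. Poly_Mapping.lookup p m = Re (Poly_Mapping.lookup (at_X_plus_iY h) m))" for p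
    by (simp add: poly_mapping_eq_iff fun_eq_iff re_part_def Poly_Mapping.map.rep_eq w)
  have Q: "q = im_part h \<longleftrightarrow>
      (\<forall>m. Poly_Mapping.lookup q m = Im (Poly_Mapping.lookup (at_X_plus_iY h) m))" for q
    by (simp add: poly_mapping_eq_iff fun_eq_iff im_part_def Poly_Mapping.map.rep_eq w)
  have "at_X_plus_iY h = complexify p + Const \<i> * complexify q \<longleftrightarrow>
      (\<forall>m. Poly_Mapping.lookup (at_X_plus_iY h) m =
        complex_of_real (Poly_Mapping.lookup p m) + \<i> * complex_of_real (Poly_Mapping.lookup q m))"
    by (simp add: poly_mapping_eq_iff fun_eq_iff lookup_add lookup_Const_mult complexify_def
        Poly_Mapping.map.rep_eq w)
  also have "\<dots> \<longleftrightarrow> p = re_part h \<and> q = im_part h"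
    unfolding P Q complex_eq_iff by auto
  finally show ?thesis .
qed

definition exponent_vector :: "('n::finite \<Rightarrow>\<^sub>0 nat) \<Rightarrow> real ^ 'n" where
  "exponent_vector m = (\<chi> k. real (Poly_Mapping.lookup m k))"

definition unlog_amoeba :: "('n::finite, complex) mpoly \<Rightarrow> (real ^ 'n) set" where
  "unlog_amoeba f = {\<chi> k. cmod (z $ k) | z. eval_mpoly f z = 0}"

text \<open>Lists \<open>(x\<^sub>1, \<dots>, x\<^sub>d)\<close> are functions on \<^typ>\<open>nat\<close> restricted to \<open>{1..d}\<close>.\<close>

definition term_values :: "(nat \<Rightarrow> complex) \<Rightarrow> (nat \<Rightarrow> 'n::finite \<Rightarrow>\<^sub>0 nat) \<Rightarrow> real ^ 'n \<Rightarrow> nat \<Rightarrow> real" where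
  "term_values b \<alpha> v j = cmod (b j) * exp (exponent_vector (\<alpha> j) \<bullet> v)"

definition dominating :: "nat \<Rightarrow> (nat \<Rightarrow> real) \<Rightarrow> nat \<Rightarrow> bool" where
  "dominating d x k \<longleftrightarrow> k \<in> {1..d} \<and> x k > (\<Sum>i\<in>{1..d} - {k}. x i)"

definition lopsided :: "nat \<Rightarrow> (nat \<Rightarrow> real) \<Rightarrow> bool" where
  "lopsided d x \<longleftrightarrow> (\<exists>k. dominating d x k)"

definition sum_of_squares :: "('v, real) mpoly \<Rightarrow> bool" where
  "sum_of_squares p \<longleftrightarrow> (\<exists>qs. p = (\<Sum>q\<leftarrow>qs. q\<^sup>2))"

text \<open>
  A certificate, of total degree at most \<open>D\<close>, that \<open>s\<^sub>1, \<dots>, s\<^sub>m\<close> have no common real zero.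
\<close>

definition certificate ::
  "nat \<Rightarrow> (nat \<Rightarrow> ('v, real) mpoly) \<Rightarrow> (nat \<Rightarrow> ('v, real) mpoly) \<Rightarrow> ('v, real) mpoly \<Rightarrow> nat \<Rightarrow> bool" where
  "certificate m s G H D \<longleftrightarrow>
     sum_of_squares H \<and>
     (\<Sum>i=1..m. s i * G i) + H + 1 = 0 \<and>
     (\<forall>i\<in>{1..m}. total_degree (s i * G i) \<le> D) \<and> total_degree H \<le> D"

end

theory Submission
  imports Defs
begin

text \<open>
  With \<open>a\<^sub>i = |b\<^sub>i|\<close> and \<open>A = a\<^sub>2 + \<dots> + a\<^sub>d\<close>, the products \<open>s\<^sub>d\<^sub>+\<^sub>1 g\<^sub>d\<^sub>+\<^sub>1\<close> and \<open>s\<^sub>d\<^sub>+\<^sub>2 g\<^sub>d\<^sub>+\<^sub>2\<close> are differences of two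
  squares, so that \<open>\<Sum> s\<^sub>i g\<^sub>i\<close> equals \<open>A\<^sup>2 - a\<^sub>1\<^sup>2\<close> minus the two Lagrange defects
  \<open>A (\<Sum> a\<^sub>i x\<^sub>i\<^sup>2) - (\<Sum> a\<^sub>i x\<^sub>i)\<^sup>2\<close>, taken for the real and for the imaginary parts. By Lagrange's identity
  these defects add up to \<open>H\<close>, and lopsidedness makes \<open>a\<^sub>1\<^sup>2 - A\<^sup>2\<close> positive.
\<close>

section \<open>Constants as a ring homomorphism into the polynomials\<close>

lemma Const_zero: "Const 0 = 0"
  by (simp add: Const_def monomial_def)

lemma Const_one: "Const 1 = 1"
  by (simp add: Const_def monomial_def)

lemma Const_add: "Const (a + b) = Const a + Const b"
  by (simp add: Const_def monomial_def single_add)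

lemma Const_uminus: "Const (- a) = - Const a" for a :: "'a::ab_group_add"
  by (simp add: Const_def monomial_def single_uminus)

lemma Const_diff: "Const (a - b) = Const a - Const b" for a b :: "'a::ab_group_add"
  using Const_add[of a "- b"] by (simp add: Const_uminus)

lemma Const_mult: "Const (a * b) = Const a * Const b" for a b :: "'a::comm_ring_1"
  by (simp add: Const_def monomial_def mult_single)

lemma Const_power: "Const (a ^ k) = Const a ^ k" for a :: "'a::comm_ring_1"
  by (induction k) (simp_all add: Const_one Const_mult)

lemma Const_sum: "Const (sum a I) = (\<Sum>i\<in>I. Const (a i))"
  by (induction I rule: infinite_finite_induct) (simp_all add: Const_zero Const_add)

text \<open>Outside the support \<open>Poly_Mapping.map\<close> yields 0 whatever \<open>h\<close>
  is; the condition \<open>h 0 = 0\<close> makes this agree with applying \<open>h\<close> to every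
  coefficient.\<close>

lemma lookup_map: "Poly_Mapping.lookup (Poly_Mapping.map h p) m = h (Poly_Mapping.lookup p m)"
  if "h 0 = 0"
  using that by (simp add: Poly_Mapping.map.rep_eq when_def)

section \<open>Additivity of substitution and of real and imaginary parts\<close>

lemma subst_mpoly_superset:
  assumes "finite M" "Poly_Mapping.keys p \<subseteq> M" "\<phi> 0 = 0"
  shows "subst_mpoly \<phi> x p =
    (\<Sum>m\<in>M. \<phi> (Poly_Mapping.lookup p m) * (\<Prod>k\<in>UNIV. x k ^ Poly_Mapping.lookup m k))"
  unfolding subst_mpoly_def
  using assms by (intro sum.mono_neutral_left) (auto simp: in_keys_iff)

text \<open>Cancellation can make the support of \<open>p + q\<close> smaller than the union of the
  two supports. All three sums are therefore extended to that union, where the extra terms vanish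
  because \<open>\<phi> 0 = 0\<close>.\<close>

lemma subst_mpoly_add:
  assumes "\<phi> 0 = 0" and "\<And>u v. \<phi> (u + v) = \<phi> u + \<phi> v"
  shows "subst_mpoly \<phi> x (p + q) = subst_mpoly \<phi> x p + subst_mpoly \<phi> x q"
proof -
  let ?M = "Poly_Mapping.keys p \<union> Poly_Mapping.keys q"
  have "subst_mpoly \<phi> x r =
      (\<Sum>m\<in>?M. \<phi> (Poly_Mapping.lookup r m) * (\<Prod>k\<in>UNIV. x k ^ Poly_Mapping.lookup m k))"
    if "Poly_Mapping.keys r \<subseteq> ?M" for r
    using that assms(1) by (intro subst_mpoly_superset) auto
  then show ?thesis
    by (simp add: Poly_Mapping.keys_add lookup_add assms(2) sum.distrib distrib_right)
qed

lemma at_X_plus_iY_add: "at_X_plus_iY (p + q) = at_X_plus_iY p + at_X_plus_iY q"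
  unfolding at_X_plus_iY_def by (intro subst_mpoly_add Const_zero Const_add)

lemma re_part_add: "re_part (p + q) = re_part p + re_part q"
  by (intro poly_mapping_eqI) (simp add: re_part_def lookup_map lookup_add at_X_plus_iY_add)

lemma im_part_add: "im_part (p + q) = im_part p + im_part q"
  by (intro poly_mapping_eqI) (simp add: im_part_def lookup_map lookup_add at_X_plus_iY_add)

lemma re_part_zero: "re_part 0 = 0"
  using re_part_add[of 0 0] by simp

lemma im_part_zero: "im_part 0 = 0"
  using im_part_add[of 0 0] by simp

lemma re_part_uminus: "re_part (- p) = - re_part p"
  using re_part_add[of p "- p"] by (simp add: re_part_zero eq_neg_iff_add_eq_0 add.commute)

lemma im_part_uminus: "im_part (- p) = - im_part p"
  using im_part_add[of p "- p"] by (simp add: im_part_zero eq_neg_iff_add_eq_0 add.commute)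

lemma re_part_sum: "re_part (sum p I) = (\<Sum>i\<in>I. re_part (p i))"
  by (induction I rule: infinite_finite_induct) (simp_all add: re_part_zero re_part_add)

lemma im_part_sum: "im_part (sum p I) = (\<Sum>i\<in>I. im_part (p i))"
  by (induction I rule: infinite_finite_induct) (simp_all add: im_part_zero im_part_add)

section \<open>Upper bounds for the total degree\<close>

definition monomial_degree :: "('v \<Rightarrow>\<^sub>0 nat) \<Rightarrow> nat" where
  "monomial_degree m = (\<Sum>x\<in>Poly_Mapping.keys m. Poly_Mapping.lookup m x)"

lemma monomial_degree_superset:
  assumes "finite V" "Poly_Mapping.keys m \<subseteq> V"
  shows "monomial_degree m = (\<Sum>x\<in>V. Poly_Mapping.lookup m x)"
  unfolding monomial_degree_def
  using assms by (intro sum.mono_neutral_left) (auto simp: in_keys_iff)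

lemma monomial_degree_add: "monomial_degree (m + m') = monomial_degree m + monomial_degree m'"
proof -
  let ?V = "Poly_Mapping.keys m \<union> Poly_Mapping.keys m'"
  have "monomial_degree r = (\<Sum>x\<in>?V. Poly_Mapping.lookup r x)" if "Poly_Mapping.keys r \<subseteq> ?V" for r
    using that by (intro monomial_degree_superset) auto
  then show ?thesis
    by (simp add: Poly_Mapping.keys_add lookup_add sum.distrib)
qed

text \<open>The 0 inserted into the maximum lies below every \<open>D\<close>, so the zero
  polynomial needs no separate treatment and degree bounds can be checked monomial by
  monomial.\<close>

lemma total_degree_le_iff:
  "total_degree p \<le> D \<longleftrightarrow> (\<forall>m\<in>Poly_Mapping.keys p. monomial_degree m \<le> D)"
  unfolding total_degree_def monomial_degree_def by (subst Max_le_iff) auto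

lemma total_degree_mono:
  assumes "Poly_Mapping.keys p \<subseteq> Poly_Mapping.keys q"
  shows "total_degree p \<le> total_degree q"
  using assms total_degree_le_iff[of q "total_degree q"] by (auto simp: total_degree_le_iff)

lemma monomial_degree_le_total_degree:
  "m \<in> Poly_Mapping.keys p \<Longrightarrow> monomial_degree m \<le> total_degree p"
  using total_degree_le_iff by blast

lemma total_degree_add_le:
  "total_degree p \<le> D \<Longrightarrow> total_degree q \<le> D \<Longrightarrow> total_degree (p + q) \<le> D"
  unfolding total_degree_le_iff by (auto dest!: subsetD[OF Poly_Mapping.keys_add])

lemma total_degree_uminus: "total_degree (- p) = total_degree p" for p :: "('v, 'a::ab_group_add) mpoly"
  by (simp add: total_degree_def Poly_Mapping.keys_def)

lemma total_degree_diff_le: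
  "total_degree p \<le> D \<Longrightarrow> total_degree q \<le> D \<Longrightarrow> total_degree (p - q) \<le> D"
  for p q :: "('v, 'a::ab_group_add) mpoly"
  using total_degree_add_le[of p D "- q"] by (simp add: total_degree_uminus)

text \<open>Each monomial of a product is a product of monomials of the factors. Cancellation can
  only delete monomials, which is harmless for an upper bound.\<close>

lemma total_degree_mult_le:
  assumes "total_degree p \<le> D" "total_degree q \<le> E"
  shows "total_degree (p * q) \<le> D + E"
  unfolding total_degree_le_iff
proof
  fix m
  assume "m \<in> Poly_Mapping.keys (p * q)"
  then obtain u v where "m = u + v" "u \<in> Poly_Mapping.keys p" "v \<in> Poly_Mapping.keys q"
    using keys_mult by blast
  then show "monomial_degree m \<le> D + E"
    using assms by (auto simp: total_degree_le_iff monomial_degree_add intro: add_mono)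
qed

lemma total_degree_Const: "total_degree (Const c) = 0"
  by (simp add: total_degree_def Const_def monomial_def)

lemma total_degree_Const_mult_le: "total_degree p \<le> D \<Longrightarrow> total_degree (Const c * p) \<le> D"
  using total_degree_mult_le[of "Const c" 0 p D] by (simp add: total_degree_Const)

lemma total_degree_one: "total_degree (1 :: ('v, 'a::comm_ring_1) mpoly) = 0"
  using total_degree_Const[of "1 :: 'a"] by (simp only: Const_one)

lemma total_degree_Var_le: "total_degree (Var x) \<le> 1"
  by (simp add: total_degree_def Var_def monomial_def)

lemma total_degree_sum_le:
  assumes "\<And>i. i \<in> I \<Longrightarrow> total_degree (p i) \<le> D"
  shows "total_degree (sum p I) \<le> D"
  using assms
proof (induction I rule: infinite_finite_induct)
  case (insert i I)
  then show ?case by (simp add: total_degree_add_le)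
qed (simp_all add: total_degree_def)

lemma total_degree_prod_le:
  fixes p :: "'i \<Rightarrow> ('v, 'a::comm_ring_1) mpoly"
  assumes "\<And>i. i \<in> I \<Longrightarrow> total_degree (p i) \<le> D i"
  shows "total_degree (prod p I) \<le> sum D I"
  using assms
  by (induction I rule: infinite_finite_induct)
    (simp_all add: total_degree_mult_le total_degree_one)

lemma total_degree_power_le:
  fixes p :: "('v, 'a::comm_ring_1) mpoly"
  assumes "total_degree p \<le> D"
  shows "total_degree (p ^ k) \<le> k * D"
  using total_degree_prod_le[of "{..<k}" "\<lambda>_. p" "\<lambda>_. D"] assms by simp

text \<open>Each variable is replaced by a polynomial of degree at most 1, so a monomial turns into
  a product of as many such factors as its degree.\<close>

lemma total_degree_at_X_plus_iY: "total_degree (at_X_plus_iY h) \<le> total_degree h"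
  unfolding at_X_plus_iY_def subst_mpoly_def
proof (intro total_degree_sum_le total_degree_Const_mult_le)
  fix m
  assume m: "m \<in> Poly_Mapping.keys h"
  let ?L = "\<lambda>k. Var (Inl k) + Const \<i> * Var (Inr k)"
  have "total_degree (?L k) \<le> 1" for k
    by (intro total_degree_add_le total_degree_Const_mult_le total_degree_Var_le)
  then have "total_degree (\<Prod>k\<in>UNIV. ?L k ^ Poly_Mapping.lookup m k)
      \<le> (\<Sum>k\<in>UNIV. Poly_Mapping.lookup m k * 1)"
    by (intro total_degree_prod_le total_degree_power_le)
  also have "\<dots> = monomial_degree m"
    by (simp add: monomial_degree_superset[of UNIV])
  also have "\<dots> \<le> total_degree h"
    using m by (rule monomial_degree_le_total_degree)
  finally show "total_degree (\<Prod>k\<in>UNIV. ?L k ^ Poly_Mapping.lookup m k) \<le> total_degree h" .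
qed

text \<open>Passing to real parts of coefficients may delete monomials but creates none.\<close>

lemma total_degree_re_part: "total_degree (re_part h) \<le> total_degree h"
proof -
  have "Poly_Mapping.keys (re_part h) \<subseteq> Poly_Mapping.keys (at_X_plus_iY h)"
    by (auto simp: re_part_def in_keys_iff lookup_map)
  then show ?thesis
    using total_degree_mono total_degree_at_X_plus_iY order_trans by blast
qed

lemma total_degree_im_part: "total_degree (im_part h) \<le> total_degree h"
proof -
  have "Poly_Mapping.keys (im_part h) \<subseteq> Poly_Mapping.keys (at_X_plus_iY h)"
    by (auto simp: im_part_def in_keys_iff lookup_map)
  then show ?thesis
    using total_degree_mono total_degree_at_X_plus_iY order_trans by blast
qed

text \<open>Distinct exponents exclude cancellation between terms: the coefficient of the sum at
  \<open>\<alpha> j\<close> is exactly \<open>b j\<close>. This lets the degree of \<open>f\<close>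
  bound every single term, and hence every polynomial built from the terms.\<close>

lemma total_degree_term_le:
  assumes "inj_on \<alpha> I" "finite I" "j \<in> I"
  shows "total_degree (monomial (\<alpha> j) (b j)) \<le> total_degree (\<Sum>i\<in>I. monomial (\<alpha> i) (b i))"
proof (rule total_degree_mono)
  have "Poly_Mapping.lookup (\<Sum>i\<in>I. monomial (\<alpha> i) (b i)) (\<alpha> j) = (\<Sum>i\<in>I. b i when i = j)"
    using assms by (auto simp: lookup_sum monomial_def lookup_single when_def inj_on_eq_iff intro!: sum.cong)
  also have "\<dots> = b j"
    using assms by (simp add: when_def)
  finally show "Poly_Mapping.keys (monomial (\<alpha> j) (b j))
      \<subseteq> Poly_Mapping.keys (\<Sum>i\<in>I. monomial (\<alpha> i) (b i))"
    by (auto simp: monomial_def in_keys_iff lookup_single when_def split: if_splits)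
qed

section \<open>Closure properties of sums of squares\<close>

lemma sum_of_squares_zero: "sum_of_squares 0"
  unfolding sum_of_squares_def by (rule exI[of _ "[]"]) simp

lemma sum_of_squares_power2: "sum_of_squares (p\<^sup>2)"
  unfolding sum_of_squares_def by (rule exI[of _ "[p]"]) simp

lemma sum_of_squares_add:
  assumes "sum_of_squares p" "sum_of_squares q"
  shows "sum_of_squares (p + q)"
proof -
  obtain ps qs where "p = (\<Sum>r\<leftarrow>ps. r\<^sup>2)" "q = (\<Sum>r\<leftarrow>qs. r\<^sup>2)"
    using assms unfolding sum_of_squares_def by blast
  then have "p + q = (\<Sum>r\<leftarrow>ps @ qs. r\<^sup>2)"
    by simp
  then show ?thesis
    unfolding sum_of_squares_def by blast
qed

lemma sum_of_squares_sum: "(\<And>i. i \<in> I \<Longrightarrow> sum_of_squares (p i)) \<Longrightarrow> sum_of_squares (sum p I)"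
  by (induction I rule: infinite_finite_induct)
    (simp_all add: sum_of_squares_zero sum_of_squares_add)

text \<open>A nonnegative real constant is the square of \<open>Const (sqrt c)\<close>, and this
  root can be absorbed into each of the squared polynomials.\<close>

lemma sum_of_squares_Const_mult:
  fixes p :: "('v, real) mpoly"
  assumes "sum_of_squares p" "0 \<le> c"
  shows "sum_of_squares (Const c * p)"
proof -
  obtain qs where "p = (\<Sum>q\<leftarrow>qs. q\<^sup>2)"
    using assms(1) unfolding sum_of_squares_def by blast
  moreover have "Const c = (Const (sqrt c) :: ('v, real) mpoly)\<^sup>2"
    using assms(2) by (simp flip: Const_power)
  ultimately have "Const c * p = (\<Sum>q\<leftarrow>map ((*) (Const (sqrt c))) qs. q\<^sup>2)"
    by (simp add: sum_list_const_mult power_mult_distrib o_def)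
  then show ?thesis
    unfolding sum_of_squares_def by blast
qed

section \<open>Ring identities: the weighted Lagrange identity and its use for the
  certificate\<close>

lemma weighted_Lagrange_identity:
  fixes a x :: "nat \<Rightarrow> 'a::comm_ring_1"
  shows "(\<Sum>i=m..n. \<Sum>j\<in>{i<..n}. a i * a j * (x i - x j)\<^sup>2) =
    (\<Sum>i=m..n. a i) * (\<Sum>i=m..n. a i * (x i)\<^sup>2) - (\<Sum>i=m..n. a i * x i)\<^sup>2"
\<comment> \<open>For nonnegative real weights this is Lagrange's identity for the vectors with
  entries \<open>sqrt (a i)\<close> and \<open>sqrt (a i) * x i\<close>. Induction on the upper
  limit avoids the roots and so works over any commutative ring.\<close>
proof (induction n)
  case 0
  show ?case by (cases m) (simp_all add: algebra_simps power2_eq_square)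
next
  case (Suc n)
  show ?case
  proof (cases "m \<le> Suc n")
    case True
    let ?A = "\<Sum>i=m..n. a i" and ?P = "\<Sum>i=m..n. a i * x i" and ?Q = "\<Sum>i=m..n. a i * (x i)\<^sup>2"
    \<comment> \<open>The contribution of the pair \<open>(i, Suc n)\<close>. Such pairs are all
      that the induction step adds, since the inner sum for \<open>i = Suc n\<close> is
      empty.\<close>
    let ?t = "\<lambda>i. a i * a (Suc n) * (x i - x (Suc n))\<^sup>2"
    have split: "(\<Sum>j\<in>{i<..Suc n}. a i * a j * (x i - x j)\<^sup>2) =
        (\<Sum>j\<in>{i<..n}. a i * a j * (x i - x j)\<^sup>2) + ?t i" if "i \<le> n" for i
    proof -
      have "{i<..Suc n} = insert (Suc n) {i<..n}" using that by auto
      then show ?thesis by (simp add: add.commute)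
    qed
    have "(\<Sum>i=m..n. ?t i) = (\<Sum>i=m..n. a (Suc n) * (a i * (x i)\<^sup>2)
        - 2 * a (Suc n) * x (Suc n) * (a i * x i) + a (Suc n) * (x (Suc n))\<^sup>2 * a i)"
      by (intro sum.cong) (auto simp: algebra_simps power2_eq_square)
    also have "\<dots> = a (Suc n) * ?Q - 2 * a (Suc n) * x (Suc n) * ?P + a (Suc n) * (x (Suc n))\<^sup>2 * ?A"
      by (simp only: sum.distrib sum_subtractf sum_distrib_left)
    finally have t: "(\<Sum>i=m..n. ?t i) = \<dots>" .
    have "(\<Sum>i=m..Suc n. \<Sum>j\<in>{i<..Suc n}. a i * a j * (x i - x j)\<^sup>2) =
        (\<Sum>i=m..n. \<Sum>j\<in>{i<..n}. a i * a j * (x i - x j)\<^sup>2) + (\<Sum>i=m..n. ?t i)"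
      using True by (simp add: split sum.distrib)
    \<comment> \<open>The products of the two new terms,
      \<open>a (Suc n) * (a (Suc n) * (x (Suc n))\<^sup>2)\<close> and
      \<open>(a (Suc n) * x (Suc n))\<^sup>2\<close>, cancel; what remains is the induction
      hypothesis plus the sum of the \<open>?t i\<close>.\<close>
    also have "\<dots> = (?A + a (Suc n)) * (?Q + a (Suc n) * (x (Suc n))\<^sup>2) - (?P + a (Suc n) * x (Suc n))\<^sup>2"
      unfolding Suc.IH t by (simp add: algebra_simps power2_eq_square)
    finally show ?thesis
      using True by simp
  qed simp
qed

text \<open>The algebra of the certificate, freed from polynomials. In the application
  \<open>a i\<close> is the constant \<open>cmod (b i)\<close>, while \<open>x i\<close> and
  \<open>y i\<close> are the normalised real and imaginary parts of the \<open>i\<close>-th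
  term.\<close>

lemma certificate_identity:
  fixes a x y :: "nat \<Rightarrow> 'a::comm_ring_1" and d :: nat
  defines "A \<equiv> \<Sum>i=2..d. a i" and "X \<equiv> \<Sum>i=2..d. a i * x i" and "Y \<equiv> \<Sum>i=2..d. a i * y i"
  shows "((x 1)\<^sup>2 + (y 1)\<^sup>2 - 1) * (a 1)\<^sup>2 + (\<Sum>i=2..d. ((x i)\<^sup>2 + (y i)\<^sup>2 - 1) * (- a i * A))
      + (a 1 * x 1 + X) * (- (a 1 * x 1) + X) + (a 1 * y 1 + Y) * (- (a 1 * y 1) + Y)
      + (\<Sum>i=2..d. \<Sum>j\<in>{i<..d}. a i * a j * ((x i - x j)\<^sup>2 + (y i - y j)\<^sup>2))
      = A\<^sup>2 - (a 1)\<^sup>2"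
proof -
  have pairs: "(\<Sum>i=2..d. \<Sum>j\<in>{i<..d}. a i * a j * ((x i - x j)\<^sup>2 + (y i - y j)\<^sup>2))
      = A * (\<Sum>i=2..d. a i * (x i)\<^sup>2) - X\<^sup>2 + (A * (\<Sum>i=2..d. a i * (y i)\<^sup>2) - Y\<^sup>2)"
    by (simp only: distrib_left sum.distrib weighted_Lagrange_identity A_def X_def Y_def)
  \<comment> \<open>The summands -1 produce \<open>A * A\<close>; the two weighted sums of squares
    are the ones that cancel against \<open>pairs\<close>.\<close>
  have terms: "(\<Sum>i=2..d. ((x i)\<^sup>2 + (y i)\<^sup>2 - 1) * (- a i * A))
      = A * A - A * (\<Sum>i=2..d. a i * (x i)\<^sup>2) - A * (\<Sum>i=2..d. a i * (y i)\<^sup>2)"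
  proof -
    have "(\<Sum>i=2..d. ((x i)\<^sup>2 + (y i)\<^sup>2 - 1) * (- a i * A))
        = (\<Sum>i=2..d. A * a i - A * (a i * (x i)\<^sup>2) - A * (a i * (y i)\<^sup>2))"
      by (intro sum.cong) (auto simp: algebra_simps)
    then show ?thesis
      by (simp only: sum_subtractf flip: sum_distrib_left) (simp add: A_def)
  qed
  show ?thesis
    unfolding pairs terms by (simp add: algebra_simps power2_eq_square)
qed

section \<open>The certificate: identity, degree bound and positivity\<close>

theorem theorem4p3:
  fixes d :: nat
    and \<alpha> :: "nat \<Rightarrow> ('n::finite \<Rightarrow>\<^sub>0 nat)"
    and b :: "nat \<Rightarrow> complex"
    and f :: "('n, complex) mpoly"
    and s g :: "nat \<Rightarrow> ('n + 'n, real) mpoly"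
    and H :: "('n + 'n, real) mpoly"
    and re im :: "nat \<Rightarrow> ('n + 'n, real) mpoly"
    and c :: real
  assumes "inj_on \<alpha> {1..d}"
    and "span ((\<lambda>j. exponent_vector (\<alpha> j)) ` {1..d}) = (UNIV :: (real ^ 'n) set)"
    and "\<And>j. j \<in> {1..d} \<Longrightarrow> b j \<noteq> 0"
    and "f = (\<Sum>j=1..d. monomial (\<alpha> j) (b j))"
    and "(\<chi> k. 1) \<in> - unlog_amoeba f"
    and "lopsided d (term_values b \<alpha> 0)"
    and "dominating d (term_values b \<alpha> 0) 1"
    and "\<And>i. re i = Const (1 / cmod (b i)) * re_part (monomial (\<alpha> i) (b i))"
    and "\<And>i. im i = Const (1 / cmod (b i)) * im_part (monomial (\<alpha> i) (b i))"
    and "\<And>i. i \<in> {1..d} \<Longrightarrow> s i = (re i)\<^sup>2 + (im i)\<^sup>2 - 1"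
    and "s (d + 1) = re_part f"
    and "s (d + 2) = im_part f"
    and "g 1 = Const ((cmod (b 1))\<^sup>2)"
    and "\<And>i. i \<in> {2..d} \<Longrightarrow> g i = Const (- cmod (b i) * (\<Sum>k=2..d. cmod (b k)))"
    and "g (d + 1) = re_part (- monomial (\<alpha> 1) (b 1) + (\<Sum>i=2..d. monomial (\<alpha> i) (b i)))"
    and "g (d + 2) = im_part (- monomial (\<alpha> 1) (b 1) + (\<Sum>i=2..d. monomial (\<alpha> i) (b i)))"
    and "H = (\<Sum>i=2..d. \<Sum>j\<in>{i<..d}.
               Const (cmod (b i) * cmod (b j)) * ((re i - re j)\<^sup>2 + (im i - im j)\<^sup>2))"
    and "c = inverse ((cmod (b 1))\<^sup>2 - (\<Sum>i=2..d. cmod (b i))\<^sup>2)"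
  shows "c > 0 \<and>
    (\<exists>G H'. certificate (d + 2) s G H' (2 * total_degree f) \<and>
      (\<forall>i\<in>{1..d + 2}. G i = Const c * g i) \<and> H' = Const c * H)"
proof -
  note inj = assms(1) and nz = assms(3) and f = assms(4) and dom = assms(7)
    and re = assms(8) and im = assms(9) and s = assms(10-12) and g = assms(13-16)
    and H = assms(17) and c = assms(18)
  define a where "a i = cmod (b i)" for i
  define A where "A = (\<Sum>i=2..d. a i)"
  let ?N = "total_degree f"

  have d: "1 \<le> d" and "A < a 1"
  proof -
    \<comment> \<open>At \<open>v = 0\<close> all exponential factors in \<open>term_values\<close>
      equal 1, so dominance of the first entry reads \<open>A < a 1\<close>; its membership
      condition supplies \<open>1 \<le> d\<close>.\<close>
    have "{1..d} - {1} = {2..d}" by auto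
    then show "1 \<le> d" and "A < a 1"
      using dom by (auto simp: dominating_def term_values_def A_def a_def)
  qed
  moreover have "0 \<le> A"
    by (simp add: A_def a_def sum_nonneg)
  ultimately have pos: "0 < (a 1)\<^sup>2 - A\<^sup>2"
    by (simp add: power_strict_mono)
  have c_eq: "c = inverse ((a 1)\<^sup>2 - A\<^sup>2)"
    by (simp add: c a_def A_def)
  have c_pos: "0 < c"
    using pos by (simp add: c_eq)

  have range_1: "{1..d} = insert 1 {2..d}"
    using d by auto
  \<comment> \<open>Since \<open>b i\<close> is nonzero, the normalisation by
    \<open>cmod (b i)\<close> can be undone. This brings \<open>f\<close> and the last two
    multipliers into the shape of \<open>certificate_identity\<close>.\<close>
  have re_term: "re_part (monomial (\<alpha> i) (b i)) = Const (a i) * re i"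
    and im_term: "im_part (monomial (\<alpha> i) (b i)) = Const (a i) * im i" if "i \<in> {1..d}" for i
    using nz[OF that] by (simp_all add: re im a_def Const_one flip: mult.assoc Const_mult)
  have s_re: "s (d + 1) = Const (a 1) * re 1 + (\<Sum>i=2..d. Const (a i) * re i)"
    and s_im: "s (d + 2) = Const (a 1) * im 1 + (\<Sum>i=2..d. Const (a i) * im i)"
    unfolding s(2,3) f re_part_sum im_part_sum range_1 using d by (simp_all add: re_term im_term)
  have g_re: "g (d + 1) = - (Const (a 1) * re 1) + (\<Sum>i=2..d. Const (a i) * re i)"
    and g_im: "g (d + 2) = - (Const (a 1) * im 1) + (\<Sum>i=2..d. Const (a i) * im i)"
    unfolding g(3,4) re_part_add im_part_add re_part_uminus im_part_uminus re_part_sum im_part_sum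
    using d by (simp_all add: re_term im_term)

  \<comment> \<open>Here \<open>1 \<le> d\<close> keeps the index 1 apart from \<open>d + 1\<close>.
    The same decomposition drives the case split for the degrees.\<close>
  have range: "{1..d + 2} = insert 1 ({2..d} \<union> {d + 1, d + 2})"
    using d by auto
  have "(\<Sum>i=1..d + 2. s i * g i) = s 1 * g 1 + (\<Sum>i=2..d. s i * g i)
      + s (d + 1) * g (d + 1) + s (d + 2) * g (d + 2)"
    unfolding range using d by (simp add: sum.union_disjoint add.assoc)
  also have "s 1 * g 1 = ((re 1)\<^sup>2 + (im 1)\<^sup>2 - 1) * (Const (a 1))\<^sup>2"
    unfolding g(1) using d by (simp add: s(1) a_def Const_power)
  also have "(\<Sum>i=2..d. s i * g i) =
      (\<Sum>i=2..d. ((re i)\<^sup>2 + (im i)\<^sup>2 - 1) * (- Const (a i) * (\<Sum>i=2..d. Const (a i))))"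
    by (intro sum.cong) (auto simp: s(1) g(2) a_def Const_mult Const_uminus Const_sum)
  finally have "(\<Sum>i=1..d + 2. s i * g i) + H = (\<Sum>i=2..d. Const (a i))\<^sup>2 - (Const (a 1))\<^sup>2"
    using certificate_identity[of re im "\<lambda>i. Const (a i)" d]
    by (simp only: s_re s_im g_re g_im H Const_mult a_def)
  also have "\<dots> = - Const ((a 1)\<^sup>2 - A\<^sup>2)"
    by (simp add: A_def Const_sum Const_power Const_diff)
  \<comment> \<open>Scaling by \<open>c\<close> turns the negative constant on the right into -1,
    which the summand 1 of the certificate cancels.\<close>
  finally have "Const c * ((\<Sum>i=1..d + 2. s i * g i) + H) = - Const (c * ((a 1)\<^sup>2 - A\<^sup>2))"
    by (simp add: Const_mult)
  also have "c * ((a 1)\<^sup>2 - A\<^sup>2) = 1"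
    using pos by (simp add: c_eq)
  finally have identity: "(\<Sum>i=1..d + 2. s i * (Const c * g i)) + Const c * H + 1 = 0"
    by (simp add: Const_one distrib_left sum_distrib_left mult.left_commute)

  have term_deg: "total_degree (monomial (\<alpha> i) (b i)) \<le> ?N" if "i \<in> {1..d}" for i
    unfolding f using inj that by (intro total_degree_term_le) auto
  have re_deg: "total_degree (re i) \<le> ?N" and im_deg: "total_degree (im i) \<le> ?N"
    if "i \<in> {1..d}" for i
    unfolding re im using term_deg[OF that] total_degree_re_part total_degree_im_part
    by (blast intro: total_degree_Const_mult_le order_trans)+
  have square_deg: "total_degree (p\<^sup>2) \<le> 2 * ?N" if "total_degree p \<le> ?N"
    for p :: "('n + 'n, real) mpoly"
    using total_degree_power_le[OF that] .
  have const_deg: "total_degree (p * Const u) \<le> D" if "total_degree p \<le> D"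
    for p :: "('n + 'n, real) mpoly" and u D
    using total_degree_Const_mult_le[OF that] by (simp add: mult.commute)
  \<comment> \<open>For \<open>i \<le> d\<close> the multiplier is a constant and \<open>s i\<close>
    is quadratic in polynomials of degree at most \<open>?N\<close>. For the last two indices both
    factors have degree at most \<open>?N\<close>.\<close>
  have "total_degree (s i * g i) \<le> 2 * ?N" if "i \<in> {1..d + 2}" for i
  proof -
    have g_deg: "total_degree (g (d + 1)) \<le> ?N" "total_degree (g (d + 2)) \<le> ?N"
      unfolding g_re g_im using d
      by (auto intro!: total_degree_diff_le total_degree_sum_le total_degree_Const_mult_le
          re_deg im_deg)
    have s_deg: "total_degree (s i) \<le> 2 * ?N" if "i \<in> {1..d}" for i
      unfolding s(1)[OF that] using that
      by (intro total_degree_diff_le total_degree_add_le square_deg re_deg im_deg)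
        (simp_all add: total_degree_one)
    from that consider "i = 1" | "i \<in> {2..d}" | "i = d + 1" | "i = d + 2"
      unfolding range by blast
    then show ?thesis
    proof cases
      case 1
      show ?thesis
        unfolding 1 g(1) using d by (intro const_deg s_deg) simp
    next
      case 2
      show ?thesis
        unfolding g(2)[OF 2] using 2 by (intro const_deg s_deg) simp
    next
      case 3
      show ?thesis
        unfolding 3 s(2) mult_2 by (intro total_degree_mult_le total_degree_re_part g_deg)
    next
      case 4
      show ?thesis
        unfolding 4 s(3) mult_2 by (intro total_degree_mult_le total_degree_im_part g_deg)
    qed
  qed
  then have sg_deg: "total_degree (s i * (Const c * g i)) \<le> 2 * ?N" if "i \<in> {1..d + 2}" for i
    using total_degree_Const_mult_le that by (metis mult.left_commute)
  have H_deg: "total_degree (Const c * H) \<le> 2 * ?N"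
    unfolding H
    by (intro total_degree_Const_mult_le total_degree_sum_le total_degree_add_le square_deg
        total_degree_diff_le re_deg im_deg) auto
  have "sum_of_squares (Const c * H)"
    unfolding H using c_pos
    by (intro sum_of_squares_Const_mult sum_of_squares_sum sum_of_squares_add
        sum_of_squares_power2) auto
  then have "certificate (d + 2) s (\<lambda>i. Const c * g i) (Const c * H) (2 * ?N)"
    unfolding certificate_def using identity sg_deg H_deg by blast
  then show ?thesis
    using c_pos by blast
qed

end
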